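(* The Cartan canonical $\Gamma$-linear connection $C\Gamma$ of the jet conformal Minkowski metric $F$ has a single effective local curvature d-tensor (all the other effective local curvature d-tensors vanish), namely $$R_{ijk}^l=\mathfrak{R}_{ijk}^l,$$ where $$\begin{aligned}\mathfrak{R}_{ijk}^l={}&\delta_j^l(\sigma_{ik}-\sigma_i\sigma_k)-\delta_k^l(\sigma_{ij}-\sigma_i\sigma_j)\\&+(1-\delta_{ij})(\sigma_{lk}-\sigma_l\sigma_k)-(1-\delta_{ik})(\sigma_{lj}-\sigma_l\sigma_j)\\&+\tfrac13(\operatorname{div}D_\sigma)\left(\sigma_k-\sigma_j+\delta_{ik}\sigma_j-\delta_{ij}\sigma_k\right)\\&+\left[\|\operatorname{grad}\sigma\|^2-\tfrac13(\operatorname{div}D_\sigma)^2\right]\left(\delta_k^l-\delta_j^l+\delta_{ik}\delta_j^l-\delta_{ij}\delta_k^l\right)\\&+\tfrac13\left[(\operatorname{div}D_\sigma)_j-(\operatorname{div}D_\sigma)_k+\delta_{ij}(\operatorname{div}D_\sigma)_k-\delta_{ik}(\operatorname{div}D_\sigma)_j\right].\end{aligned}$$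
   Context: $h_{11}(t)>0$ is a smooth Riemannian metric on $\mathbb{R}$, $h^{11}=1/h_{11}$, and $\varkappa_{11}^1=\frac{h^{11}}{2}\frac{dh_{11}}{dt}$. $M^4$ is a smooth 4-manifold with local coordinates $x=(x^1,\dots,x^4)$, and $\sigma$ is a smooth non-constant function on $M^4$. The 1-jet space $J^1(\mathbb{R},M^4)$ has local coordinates $(t,x,y)$, $y=(y_1^1,\dots,y_1^4)$. The jet conformal Minkowski metric is $F(t,x,y)=e^{\sigma(x)}\sqrt{h^{11}(t)}\sqrt{G_{11}(y)}$ with $G_{11}(y)=y_1^1y_1^2+y_1^1y_1^3+y_1^1y_1^4+y_1^2y_1^3+y_1^2y_1^4+y_1^3y_1^4$, on the domain $G_{11}(y)>0$. Latin indices run from 1 to 4, the Einstein summation convention is used for an index repeated in upper and lower position, and $\delta^i_j,\delta_{ij}$ are Kronecker symbols. Notation: $\sigma_i=\partial\sigma/\partial x^i$, $\sigma_{ij}=\partial^2\sigma/\partial x^i\partial x^j$, $\|\operatorname{grad}\sigma\|^2=\sigma_1^2+\sigma_2^2+\sigma_3^2+\sigma_4^2$, $\operatorname{div}D_\sigma=\sigma_1+\sigma_2+\sigma_3+\sigma_4$, $(\operatorname{div}D_\sigma)_i=\partial(\operatorname{div}D_\sigma)/\partial x^i=\sigma_{1i}+\sigma_{2i}+\sigma_{3i}+\sigma_{4i}$, $S_{[1]1}=y_1^1+y_1^2+y_1^3+y_1^4$. The canonical nonlinear connection of $F$ has components $M_{(1)1}^{(i)}=-\varkappa_{11}^1y_1^i$,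 $N_{(1)j}^{(i)}=\sigma_jy_1^i+\sigma_my_1^m\delta_j^i+[\sigma_i-\frac13\operatorname{div}D_\sigma](S_{[1]1}-y_1^j)$, and the adapted basis of vector fields is $\frac{\delta}{\delta t}=\frac{\partial}{\partial t}+\varkappa_{11}^1y_1^p\frac{\partial}{\partial y_1^p}$, $\frac{\delta}{\delta x^i}=\frac{\partial}{\partial x^i}-N_{(1)i}^{(p)}\frac{\partial}{\partial y_1^p}$, $\frac{\partial}{\partial y_1^i}$. The Cartan canonical connection $C\Gamma$ has adapted components $(\varkappa_{11}^1,\ G_{j1}^k=0,\ L_{jk}^i,\ C_{j(k)}^{i(1)}=0)$ with $L_{jk}^i=\delta_j^i\sigma_k+\delta_k^i\sigma_j+(1-\delta_{jk})\sigma_i-\frac{1-\delta_{jk}}{3}\operatorname{div}D_\sigma$; that is, it is the linear connection $\nabla$ on $J^1(\mathbb{R},M^4)$ given by $$\nabla_{\frac{\delta}{\delta t}}\tfrac{\delta}{\delta t}=\varkappa_{11}^1\tfrac{\delta}{\delta t},\quad\nabla_{\frac{\delta}{\delta t}}\tfrac{\delta}{\delta x^j}=0,\quad\nabla_{\frac{\delta}{\delta t}}\tfrac{\partial}{\partial y_1^j}=-\varkappa_{11}^1\tfrac{\partial}{\partial y_1^j},$$ $$\nabla_{\frac{\delta}{\delta x^k}}\tfrac{\delta}{\delta t}=0,\quad\nabla_{\frac{\delta}{\delta x^k}}\tfrac{\delta}{\delta x^j}=L_{jk}^i\tfrac{\delta}{\delta x^i},\quad\nabla_{\frac{\delta}{\delta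 x^k}}\tfrac{\partial}{\partial y_1^j}=L_{jk}^i\tfrac{\partial}{\partial y_1^i},$$ and $\nabla_{\frac{\partial}{\partial y_1^k}}$ annihilates all adapted basis fields. Its curvature is $\mathbf{R}(X,Y)Z=\nabla_X\nabla_YZ-\nabla_Y\nabla_XZ-\nabla_{[X,Y]}Z$. The d-tensor $R_{ijk}^l$ is defined by $\mathbf{R}\left(\frac{\delta}{\delta x^k},\frac{\delta}{\delta x^j}\right)\frac{\delta}{\delta x^i}=R_{ijk}^l\frac{\delta}{\delta x^l}$, i.e. (since $C_{j(k)}^{i(1)}=0$) $R_{ijk}^l=\frac{\delta L_{ij}^l}{\delta x^k}-\frac{\delta L_{ik}^l}{\delta x^j}+L_{ij}^rL_{rk}^l-L_{ik}^rL_{rj}^l$. The same $R_{ijk}^l$ also gives the curvature on vertical fields, $\mathbf{R}\left(\frac{\delta}{\delta x^k},\frac{\delta}{\delta x^j}\right)\frac{\partial}{\partial y_1^i}=R_{ijk}^l\frac{\partial}{\partial y_1^l}$, and is not counted as a separate d-tensor there. "Single effective" means that all remaining adapted curvature components vanish identically. *)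

theory Defs
  imports "HOL-Analysis.Analysis"
begin

section \<open>Smooth functions and smooth 4-manifolds\<close>

fun Ck_on :: "nat \<Rightarrow> 'a::euclidean_space set \<Rightarrow> ('a \<Rightarrow> real) \<Rightarrow> bool" where
  "Ck_on 0 S f \<longleftrightarrow> continuous_on S f"
| "Ck_on (Suc k) S f \<longleftrightarrow> f differentiable_on S \<and>
     (\<forall>b\<in>Basis. Ck_on k S (\<lambda>x. frechet_derivative f (at x) b))"

text \<open>Only used for open \<open>S\<close>.\<close>

definition smooth_on :: "'a::euclidean_space set \<Rightarrow> ('a \<Rightarrow> real) \<Rightarrow> bool" where
  "smooth_on S f \<longleftrightarrow> (\<forall>k. Ck_on k S f)"

text \<open>A chart is a pair of a coordinate domain and a coordinate map; the values of the
  map outside the domain are irrelevant.\<close>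

type_synonym 'm chart = "'m set \<times> ('m \<Rightarrow> real^4)"

definition coord_rep :: "'m chart \<Rightarrow> ('m \<Rightarrow> 'b) \<Rightarrow> real^4 \<Rightarrow> 'b" where
  "coord_rep c f x = f (inv_into (fst c) (snd c) x)"

definition coord_range :: "'m chart \<Rightarrow> (real^4) set" where
  "coord_range c = snd c ` fst c"

definition smooth_atlas :: "'m topology \<Rightarrow> 'm chart set \<Rightarrow> bool" where
  "smooth_atlas M \<A> \<longleftrightarrow>
     (\<Union>c\<in>\<A>. fst c) = topspace M \<and>
     (\<forall>c\<in>\<A>. openin M (fst c) \<and> open (coord_range c) \<and>
        homeomorphic_map (subtopology M (fst c)) (top_of_set (coord_range c)) (snd c)) \<and>
     (\<forall>c\<in>\<A>. \<forall>d\<in>\<A>. \<forall>i.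
        smooth_on (snd c ` (fst c \<inter> fst d)) (\<lambda>x. coord_rep c (snd d) x $ i))"

definition smooth_manifold :: "'m topology \<Rightarrow> 'm chart set \<Rightarrow> bool" where
  "smooth_manifold M \<A> \<longleftrightarrow> Hausdorff_space M \<and> second_countable M \<and> smooth_atlas M \<A>"

definition smooth_function :: "'m chart set \<Rightarrow> ('m \<Rightarrow> real) \<Rightarrow> bool" where
  "smooth_function \<A> f \<longleftrightarrow> (\<forall>c\<in>\<A>. smooth_on (coord_range c) (coord_rep c f))"


section \<open>Derivatives of the conformal factor\<close>

text \<open>From here on \<open>s\<close> is the representation of \<open>\<sigma>\<close> in the local coordinates \<open>x\<close>, and
  \<open>h\<close> is \<open>h\<^sub>1\<^sub>1\<close>.\<close>

definition partial :: "4 \<Rightarrow> (real^4 \<Rightarrow> real) \<Rightarrow> real^4 \<Rightarrow> real" where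
  "partial i f x = frechet_derivative f (at x) (axis i 1)"

definition kdelta :: "4 \<Rightarrow> 4 \<Rightarrow> real" where
  "kdelta i j = (if i = j then 1 else 0)"

definition grad_norm_sq :: "(real^4 \<Rightarrow> real) \<Rightarrow> real^4 \<Rightarrow> real" where
  "grad_norm_sq s x = (\<Sum>i\<in>UNIV. (partial i s x)\<^sup>2)"

definition divD :: "(real^4 \<Rightarrow> real) \<Rightarrow> real^4 \<Rightarrow> real" where
  "divD s x = (\<Sum>i\<in>UNIV. partial i s x)"


section \<open>The jet conformal Minkowski metric\<close>

text \<open>Points of the 1-jet space in local coordinates \<open>(t, x, y)\<close>.\<close>

type_synonym jet = "real \<times> (real^4) \<times> (real^4)"

abbreviation jt :: "jet \<Rightarrow> real" where "jt p \<equiv> fst p"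
abbreviation jx :: "jet \<Rightarrow> real^4" where "jx p \<equiv> fst (snd p)"
abbreviation jy :: "jet \<Rightarrow> real^4" where "jy p \<equiv> snd (snd p)"

definition G11 :: "real^4 \<Rightarrow> real" where
  "G11 y = y$1 * y$2 + y$1 * y$3 + y$1 * y$4 + y$2 * y$3 + y$2 * y$4 + y$3 * y$4"

definition jet_conformal_Minkowski ::
  "(real \<Rightarrow> real) \<Rightarrow> (real^4 \<Rightarrow> real) \<Rightarrow> jet \<Rightarrow> real" where
  "jet_conformal_Minkowski h s p = exp (s (jx p)) * sqrt (1 / h (jt p)) * sqrt (G11 (jy p))"

definition jet_domain :: "(real^4) set \<Rightarrow> jet set" where
  "jet_domain U = {p. jx p \<in> U \<and> G11 (jy p) > 0}"

definition kappa :: "(real \<Rightarrow> real) \<Rightarrow> real \<Rightarrow> real" where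
  "kappa h t = (1 / h t) / 2 * deriv h t"


section \<open>Nonlinear connection and adapted frame\<close>

definition S1 :: "real^4 \<Rightarrow> real" where
  "S1 y = (\<Sum>i\<in>UNIV. y $ i)"

definition nlc_M :: "(real \<Rightarrow> real) \<Rightarrow> 4 \<Rightarrow> jet \<Rightarrow> real" where
  "nlc_M h i p = - kappa h (jt p) * jy p $ i"

text \<open>\<open>nlc_N s i j\<close> has upper index \<open>i\<close> and lower index \<open>j\<close>.\<close>

definition nlc_N :: "(real^4 \<Rightarrow> real) \<Rightarrow> 4 \<Rightarrow> 4 \<Rightarrow> jet \<Rightarrow> real" where
  "nlc_N s i j p =
     partial j s (jx p) * jy p $ i
     + (\<Sum>m\<in>UNIV. partial m s (jx p) * jy p $ m) * kdelta i j
     + (partial i s (jx p) - divD s (jx p) / 3) * (S1 (jy p) - jy p $ j)"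

text \<open>Vector fields are given by their components in the natural frame
  \<open>\<partial>/\<partial>t, \<partial>/\<partial>x\<^sup>i, \<partial>/\<partial>y\<^sup>i\<close>.\<close>

type_synonym vfield = "jet \<Rightarrow> jet"

definition lie_deriv :: "vfield \<Rightarrow> (jet \<Rightarrow> real) \<Rightarrow> jet \<Rightarrow> real" where
  "lie_deriv X f p = frechet_derivative f (at p) (X p)"

definition lie_bracket :: "vfield \<Rightarrow> vfield \<Rightarrow> vfield" where
  "lie_bracket X Y p =
     frechet_derivative Y (at p) (X p) - frechet_derivative X (at p) (Y p)"

text \<open>Indices of the adapted frame: \<open>\<delta>/\<delta>t\<close>, \<open>\<delta>/\<delta>x\<^sup>i\<close>, \<open>\<partial>/\<partial>y\<^sup>i\<close>.\<close>

datatype adapted = T | H 4 | V 4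

definition sum_adapted :: "(adapted \<Rightarrow> 'b::comm_monoid_add) \<Rightarrow> 'b" where
  "sum_adapted f = f T + (\<Sum>i\<in>UNIV. f (H i)) + (\<Sum>i\<in>UNIV. f (V i))"

fun frame :: "(real \<Rightarrow> real) \<Rightarrow> (real^4 \<Rightarrow> real) \<Rightarrow> adapted \<Rightarrow> vfield" where
  "frame h s T p = (1, 0, (\<chi> i. - nlc_M h i p))"
| "frame h s (H j) p = (0, axis j 1, (\<chi> i. - nlc_N s i j p))"
| "frame h s (V j) p = (0, 0, axis j 1)"

text \<open>Components of a vector field in the adapted frame, i.e. its values under the dual
  coframe \<open>dt, dx\<^sup>i, \<delta>y\<^sup>i = dy\<^sup>i + M\<^sup>i dt + N\<^sup>i\<^sub>j dx\<^sup>j\<close>.\<close>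

fun coeff :: "(real \<Rightarrow> real) \<Rightarrow> (real^4 \<Rightarrow> real) \<Rightarrow> adapted \<Rightarrow> vfield \<Rightarrow> jet \<Rightarrow> real" where
  "coeff h s T X p = jt (X p)"
| "coeff h s (H i) X p = jx (X p) $ i"
| "coeff h s (V i) X p =
     jy (X p) $ i + nlc_M h i p * jt (X p) + (\<Sum>j\<in>UNIV. nlc_N s i j p * jx (X p) $ j)"


section \<open>The Cartan canonical connection and its curvature\<close>

text \<open>\<open>cartan_L s i j k\<close> is \<open>L\<^sup>i\<^sub>j\<^sub>k\<close>.\<close>

definition cartan_L :: "(real^4 \<Rightarrow> real) \<Rightarrow> 4 \<Rightarrow> 4 \<Rightarrow> 4 \<Rightarrow> real^4 \<Rightarrow> real" where
  "cartan_L s i j k x =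
     kdelta i j * partial k s x + kdelta i k * partial j s x
     + (1 - kdelta j k) * partial i s x - (1 - kdelta j k) / 3 * divD s x"

text \<open>\<open>cartan_frame h s b a\<close> is the covariant derivative of the frame field \<open>a\<close> along the
  frame field \<open>b\<close>.\<close>

fun cartan_frame ::
  "(real \<Rightarrow> real) \<Rightarrow> (real^4 \<Rightarrow> real) \<Rightarrow> adapted \<Rightarrow> adapted \<Rightarrow> vfield" where
  "cartan_frame h s T T p = kappa h (jt p) *\<^sub>R frame h s T p"
| "cartan_frame h s T (H j) p = 0"
| "cartan_frame h s T (V j) p = - kappa h (jt p) *\<^sub>R frame h s (V j) p"
| "cartan_frame h s (H k) T p = 0"
| "cartan_frame h s (H k) (H j) p = (\<Sum>i\<in>UNIV. cartan_L s i j k (jx p) *\<^sub>R frame h s (H i) p)"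
| "cartan_frame h s (H k) (V j) p = (\<Sum>i\<in>UNIV. cartan_L s i j k (jx p) *\<^sub>R frame h s (V i) p)"
| "cartan_frame h s (V k) a p = 0"

text \<open>The linear connection with these values on the adapted frame, extended to all vector
  fields \<open>X = X\<^sup>b e\<^sub>b\<close>, \<open>Y = Y\<^sup>a e\<^sub>a\<close> by tensoriality in \<open>X\<close> and the Leibniz rule in \<open>Y\<close>.\<close>

definition cartan_nabla ::
  "(real \<Rightarrow> real) \<Rightarrow> (real^4 \<Rightarrow> real) \<Rightarrow> vfield \<Rightarrow> vfield \<Rightarrow> vfield" where
  "cartan_nabla h s X Y p =
     sum_adapted (\<lambda>a. lie_deriv X (coeff h s a Y) p *\<^sub>R frame h s a p
       + sum_adapted (\<lambda>b. (coeff h s b X p * coeff h s a Y p) *\<^sub>R cartan_frame h s b a p))"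

definition cartan_curvature ::
  "(real \<Rightarrow> real) \<Rightarrow> (real^4 \<Rightarrow> real) \<Rightarrow> vfield \<Rightarrow> vfield \<Rightarrow> vfield \<Rightarrow> vfield" where
  "cartan_curvature h s X Y Z p =
     cartan_nabla h s X (cartan_nabla h s Y Z) p - cartan_nabla h s Y (cartan_nabla h s X Z) p
     - cartan_nabla h s (lie_bracket X Y) Z p"

text \<open>The component along \<open>e\<^sub>d\<close> of \<open>\<^bold>R(e\<^sub>c, e\<^sub>b) e\<^sub>a\<close>.\<close>

definition curv_comp ::
  "(real \<Rightarrow> real) \<Rightarrow> (real^4 \<Rightarrow> real) \<Rightarrow> adapted \<Rightarrow> adapted \<Rightarrow> adapted \<Rightarrow> adapted \<Rightarrow> jet \<Rightarrow> real" where
  "curv_comp h s d a b c =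
     coeff h s d (cartan_curvature h s (frame h s c) (frame h s b) (frame h s a))"

text \<open>\<open>curv_R h s l i j k\<close> is \<open>R\<^sup>l\<^sub>i\<^sub>j\<^sub>k\<close>.\<close>

definition curv_R ::
  "(real \<Rightarrow> real) \<Rightarrow> (real^4 \<Rightarrow> real) \<Rightarrow> 4 \<Rightarrow> 4 \<Rightarrow> 4 \<Rightarrow> 4 \<Rightarrow> jet \<Rightarrow> real" where
  "curv_R h s l i j k = curv_comp h s (H l) (H i) (H j) (H k)"

definition frakR :: "(real^4 \<Rightarrow> real) \<Rightarrow> 4 \<Rightarrow> 4 \<Rightarrow> 4 \<Rightarrow> 4 \<Rightarrow> real^4 \<Rightarrow> real" where
  "frakR s l i j k x =
    (let \<sigma>1 = (\<lambda>a. partial a s x);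
         \<sigma>2 = (\<lambda>a b. partial b (partial a s) x);
         D = divD s x;
         D1 = (\<lambda>a. partial a (divD s) x);
         \<delta> = kdelta
     in \<delta> l j * (\<sigma>2 i k - \<sigma>1 i * \<sigma>1 k) - \<delta> l k * (\<sigma>2 i j - \<sigma>1 i * \<sigma>1 j)
      + (1 - \<delta> i j) * (\<sigma>2 l k - \<sigma>1 l * \<sigma>1 k) - (1 - \<delta> i k) * (\<sigma>2 l j - \<sigma>1 l * \<sigma>1 j)
      + 1/3 * D * (\<sigma>1 k - \<sigma>1 j + \<delta> i k * \<sigma>1 j - \<delta> i j * \<sigma>1 k)
      + (grad_norm_sq s x - 1/3 * D\<^sup>2) * (\<delta> l k - \<delta> l j + \<delta> i k * \<delta> l j - \<delta> i j * \<delta> l k)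
      + 1/3 * (D1 j - D1 k + \<delta> i j * D1 k - \<delta> i k * D1 j))"


section \<open>Consistency of the encoding\<close>

text \<open>\<open>coeff\<close> is dual to \<open>frame\<close>, and every vector field is recovered from its components.\<close>

lemma axis1: "axis i (1::real) $ j = (if i = j then 1 else 0)" by (simp add: axis_def)

lemma coeff_frame: "coeff h s b (frame h s a) p = (if a = b then 1 else 0)"
proof -
  have *: "(\<Sum>j\<in>UNIV. f j * axis i 1 $ j) = f i" for f :: "4 \<Rightarrow> real" and i
    by (simp add: axis1 mult_delta_right)
  show ?thesis
    by (cases a; cases b) (simp_all add: * axis1 mult_delta_right)
qed

lemma frame_expansion: "X p = sum_adapted (\<lambda>a. coeff h s a X p *\<^sub>R frame h s a p)"
proof -
  have 1: "(\<Sum>i\<in>UNIV. v i * axis i 1 $ k) = v k" for v :: "4 \<Rightarrow> real" and k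
    by (simp add: axis1 mult_delta_right)
  have "jt (sum_adapted (\<lambda>a. coeff h s a X p *\<^sub>R frame h s a p)) = jt (X p)"
    by (simp add: sum_adapted_def fst_sum)
  moreover have "jx (sum_adapted (\<lambda>a. coeff h s a X p *\<^sub>R frame h s a p)) $ k = jx (X p) $ k" for k
    by (simp add: sum_adapted_def fst_sum snd_sum 1)
  moreover have "jy (sum_adapted (\<lambda>a. coeff h s a X p *\<^sub>R frame h s a p)) $ k = jy (X p) $ k" for k
  proof -
    have "jy (sum_adapted (\<lambda>a. coeff h s a X p *\<^sub>R frame h s a p)) $ k
      = - jt (X p) * nlc_M h k p - (\<Sum>j\<in>UNIV. nlc_N s k j p * jx (X p) $ j)
       + coeff h s (V k) X p"
      by (simp add: sum_adapted_def snd_sum sum_negf 1 mult.commute[of _ "jt (X p)"]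
          mult.commute[of _ "jx (X p) $ _"] del: coeff.simps(3))
    then show ?thesis by simp
  qed
  ultimately show ?thesis by (simp add: prod_eq_iff vec_eq_iff)
qed

text \<open>The connection takes the prescribed values on the adapted frame.\<close>

lemma cartan_nabla_frame:
  "cartan_nabla h s (frame h s b) (frame h s a) p = cartan_frame h s b a p"
proof -
  have "lie_deriv (frame h s b) (coeff h s c (frame h s a)) p = 0" for c
  proof -
    have "coeff h s c (frame h s a) = (\<lambda>p. if a = c then 1 else 0)"
      by (rule ext) (rule coeff_frame)
    then show ?thesis
      by (simp add: lie_deriv_def)
  qed
  moreover have *: "sum_adapted (\<lambda>c. (if a = c then 1 else 0) *\<^sub>R f c) = f a"
    for f :: "adapted \<Rightarrow> jet" and a
  proof (cases a)
    case T
    then show ?thesis by (simp add: sum_adapted_def)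
  next
    case (H i)
    have "(\<Sum>j\<in>UNIV. (if i = j then 1 else 0) *\<^sub>R f (H j)) = (\<Sum>j\<in>UNIV. if i = j then f (H j) else 0)"
      by (rule sum.cong) simp_all
    then show ?thesis using H by (simp add: sum_adapted_def)
  next
    case (V i)
    have "(\<Sum>j\<in>UNIV. (if i = j then 1 else 0) *\<^sub>R f (V j)) = (\<Sum>j\<in>UNIV. if i = j then f (V j) else 0)"
      by (rule sum.cong) simp_all
    then show ?thesis using V by (simp add: sum_adapted_def)
  qed
  moreover have "sum_adapted (\<lambda>c. sum_adapted (\<lambda>d. (u d * w c) *\<^sub>R f d c)) =
      sum_adapted (\<lambda>c. w c *\<^sub>R sum_adapted (\<lambda>d. u d *\<^sub>R f d c))"
    for u w :: "adapted \<Rightarrow> real" and f :: "adapted \<Rightarrow> adapted \<Rightarrow> jet"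
    by (simp add: sum_adapted_def scaleR_add_right scaleR_sum_right mult.commute)
  ultimately show ?thesis
    unfolding cartan_nabla_def coeff_frame by simp
qed

text \<open>Relation to the metric function: with
  \<open>g\<^sub>i\<^sub>j = e\<^bsup>2\<sigma>\<^esup> (1 - \<delta>\<^sub>i\<^sub>j) / 2\<close> one has \<open>F\<^sup>2 = h\<^sup>1\<^sup>1 g\<^sub>i\<^sub>j y\<^sup>i y\<^sup>j\<close>, the coefficients
  \<open>L\<^sup>i\<^sub>j\<^sub>k\<close> are symmetric in \<open>j, k\<close> and parallelize \<open>g\<close>, and \<open>N\<^sup>i\<^sub>j = L\<^sup>i\<^sub>j\<^sub>k y\<^sup>k\<close>.\<close>

definition metric_g :: "(real^4 \<Rightarrow> real) \<Rightarrow> 4 \<Rightarrow> 4 \<Rightarrow> real^4 \<Rightarrow> real" where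
  "metric_g s i j x = exp (2 * s x) * (1 - kdelta i j) / 2"

lemma F_squared:
  assumes "h (jt p) > 0" "G11 (jy p) > 0"
  shows "(jet_conformal_Minkowski h s p)\<^sup>2 =
    1 / h (jt p) * (\<Sum>i\<in>UNIV. \<Sum>j\<in>UNIV. metric_g s i j (jx p) * jy p $ i * jy p $ j)"
proof -
  have "(jet_conformal_Minkowski h s p)\<^sup>2 = 1 / h (jt p) * (exp (2 * s (jx p)) * G11 (jy p))"
    using assms by (simp add: jet_conformal_Minkowski_def power_mult_distrib exp_double)
  also have "exp (2 * s (jx p)) * G11 (jy p) =
      (\<Sum>i\<in>UNIV. \<Sum>j\<in>UNIV. metric_g s i j (jx p) * jy p $ i * jy p $ j)"
    by (simp add: sum_4 metric_g_def kdelta_def G11_def algebra_simps)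
  finally show ?thesis .
qed

lemma cartan_L_sym: "cartan_L s i j k x = cartan_L s i k j x"
  by (auto simp: cartan_L_def kdelta_def)

lemma kdelta_sum:
  "(\<Sum>m\<in>UNIV. kdelta m i * f m) = f i" "(\<Sum>m\<in>UNIV. kdelta i m * f m) = f i"
  by (simp_all add: kdelta_def mult_delta_left)

lemma nlc_N_cartan_L: "nlc_N s i j p = (\<Sum>k\<in>UNIV. cartan_L s i j k (jx p) * jy p $ k)"
proof -
  define a where "a m = partial m s (jx p)" for m
  define y where "y = jy p"
  have "(\<Sum>k\<in>UNIV. cartan_L s i j k (jx p) * y $ k) =
     (\<Sum>k\<in>UNIV. kdelta i j * (a k * y $ k) + kdelta i k * (a j * y $ k)
       + (a i - divD s (jx p) / 3) * y $ k - kdelta j k * ((a i - divD s (jx p) / 3) * y $ k))"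
    by (rule sum.cong) (auto simp: cartan_L_def a_def algebra_simps add_divide_distrib diff_divide_distrib)
  also have "\<dots> = kdelta i j * (\<Sum>k\<in>UNIV. a k * y $ k) + a j * y $ i
      + (a i - divD s (jx p) / 3) * S1 y - (a i - divD s (jx p) / 3) * y $ j"
    by (simp add: sum.distrib sum_subtractf kdelta_sum S1_def flip: sum_distrib_left)
  also have "\<dots> = nlc_N s i j p"
    by (simp add: nlc_N_def a_def y_def algebra_simps)
  finally show ?thesis by (simp add: y_def)
qed

lemma cartan_L_metric:
  assumes "s differentiable (at x)"
  shows "partial k (metric_g s i j) x =
    (\<Sum>m\<in>UNIV. cartan_L s m i k x * metric_g s m j x + cartan_L s m j k x * metric_g s i m x)"
proof -
  have "(s has_derivative frechet_derivative s (at x)) (at x)"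
    using assms frechet_derivative_works by blast
  then have "(metric_g s i j has_derivative
      (\<lambda>v. exp (2 * s x) * (1 - kdelta i j) * frechet_derivative s (at x) v)) (at x)"
    unfolding metric_g_def by (auto intro!: derivative_eq_intros simp: field_simps)
  from frechet_derivative_at[OF this, symmetric]
  have d: "partial k (metric_g s i j) x = exp (2 * s x) * (1 - kdelta i j) * partial k s x"
    by (simp add: partial_def)
  define E where "E = exp (2 * s x) / 2"
  define a where "a m = partial m s x" for m
  have a: "divD s x = sum a UNIV" by (simp add: a_def divD_def)
  define q where "q i = (1 - kdelta i k) / 3 * divD s x" for i
  have half: "(\<Sum>m\<in>UNIV. cartan_L s m i k x * (1 - kdelta m j)) =
      (1 - kdelta i j) * a k + (1 - kdelta k j) * a i - (1 - kdelta i k) * a j" for i j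
  proof -
    have "(\<Sum>m\<in>UNIV. cartan_L s m i k x * (1 - kdelta m j)) =
      (\<Sum>m\<in>UNIV. kdelta m i * ((1 - kdelta m j) * a k) + kdelta m k * ((1 - kdelta m j) * a i)
        + (1 - kdelta i k) * a m - kdelta m j * ((1 - kdelta i k) * a m) 
        - q i + kdelta m j * q i)"
      by (rule sum.cong) (auto simp: cartan_L_def a_def q_def algebra_simps add_divide_distrib diff_divide_distrib)
    also have "\<dots> = (1 - kdelta i j) * a k + (1 - kdelta k j) * a i
        + (1 - kdelta i k) * divD s x - (1 - kdelta i k) * a j
        - 4 * q i + q i"
      unfolding a by (simp add: sum.distrib sum_subtractf kdelta_sum flip: sum_distrib_left)
    also have "\<dots> = (1 - kdelta i j) * a k + (1 - kdelta k j) * a i - (1 - kdelta i k) * a j"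
      by (simp add: q_def field_simps)
    finally show ?thesis .
  qed
  have c: "kdelta u v = kdelta v u" for u v by (auto simp: kdelta_def)
  have "(\<Sum>m\<in>UNIV. cartan_L s m i k x * metric_g s m j x + cartan_L s m j k x * metric_g s i m x)
      = E * (\<Sum>m\<in>UNIV. cartan_L s m i k x * (1 - kdelta m j))
      + E * (\<Sum>m\<in>UNIV. cartan_L s m j k x * (1 - kdelta m i))"
    unfolding sum_distrib_left sum.distrib[symmetric]
    by (rule sum.cong) (simp_all add: metric_g_def E_def c[of i] algebra_simps add_divide_distrib diff_divide_distrib)
  also have "\<dots> = 2 * E * (1 - kdelta i j) * a k"
    unfolding half c[of k] c[of j i] by (simp add: algebra_simps)
  finally show ?thesis by (simp add: d E_def a_def)
qed

end

theory Submission
  imports Defs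
begin

text \<open>In the adapted frame the components of \<open>C\<Gamma>\<close> depend on \<open>t\<close> or on \<open>x\<close> alone, never on \<open>y\<close>, and all
  derivatives along \<open>\<partial>/\<partial>y\<^sup>i\<close> vanish. Brackets of frame fields are vertical, so they do not
  contribute to the curvature, which becomes
  \<open>e\<^sub>c \<Gamma>\<^sup>d\<^sub>b\<^sub>a - e\<^sub>b \<Gamma>\<^sup>d\<^sub>c\<^sub>a + \<Gamma>\<^sup>r\<^sub>b\<^sub>a \<Gamma>\<^sup>d\<^sub>c\<^sub>r - \<Gamma>\<^sup>r\<^sub>c\<^sub>a \<Gamma>\<^sup>d\<^sub>b\<^sub>r\<close>. The temporal coefficients are multiples of the
  identity depending on \<open>t\<close> only, so only the purely horizontal pairs of directions survive.
  There the symmetry of \<open>\<sigma>\<^sub>i\<^sub>j\<close> and the contraction of \<open>L\<close> with itself give the stated tensor.\<close>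

section \<open>Symmetry of mixed second derivatives\<close>

text \<open>The chain rule along an affine line turns a directional derivative into an ordinary one,
  so that the one-variable mean value theorem becomes applicable.\<close>

lemma has_real_derivative_along_line:
  fixes f :: "'a::real_normed_vector \<Rightarrow> real"
  assumes "f differentiable (at (c + u *\<^sub>R a))"
  shows "((\<lambda>u. f (c + u *\<^sub>R a)) has_real_derivative
    frechet_derivative f (at (c + u *\<^sub>R a)) a) (at u)"
proof -
  let ?D = "frechet_derivative f (at (c + u *\<^sub>R a))"
  have D: "(f has_derivative ?D) (at (c + u *\<^sub>R a))"
    using assms frechet_derivative_works by blast
  have "((\<lambda>u. c + u *\<^sub>R a) has_derivative (\<lambda>v. v *\<^sub>R a)) (at u)"
    by (auto intro!: derivative_eq_intros)
  from diff_chain_at[OF this D]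
  have "((\<lambda>u. f (c + u *\<^sub>R a)) has_derivative (\<lambda>v. ?D (v *\<^sub>R a))) (at u)"
    by (simp add: o_def)
  moreover have "?D (v *\<^sub>R a) = ?D a * v" for v
    using linear_cmul[OF has_derivative_linear[OF D], of v a] by simp
  ultimately show ?thesis
    by (simp add: has_field_derivative_def)
qed

text \<open>Two applications of the mean value theorem, first along \<open>a\<close> and then along
  \<open>b\<close>. The set \<open>S\<close> has to contain the whole parallelogram on which the
  intermediate points may fall.\<close>

lemma second_difference_mvt:
  fixes f :: "'a::real_normed_vector \<Rightarrow> real"
  assumes "t > 0"
    and S: "\<And>u v. 0 \<le> u \<Longrightarrow> u \<le> t \<Longrightarrow> 0 \<le> v \<Longrightarrow> v \<le> t \<Longrightarrow> x + u *\<^sub>R a + v *\<^sub>R b \<in> S"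
    and f: "\<And>z. z \<in> S \<Longrightarrow> f differentiable (at z)"
    and f': "\<And>z. z \<in> S \<Longrightarrow> (\<lambda>z. frechet_derivative f (at z) a) differentiable (at z)"
  shows "\<exists>u\<in>{0<..<t}. \<exists>v\<in>{0<..<t}.
    f (x + t *\<^sub>R a + t *\<^sub>R b) - f (x + t *\<^sub>R a) - f (x + t *\<^sub>R b) + f x =
      t\<^sup>2 * frechet_derivative (\<lambda>z. frechet_derivative f (at z) a) (at (x + u *\<^sub>R a + v *\<^sub>R b)) b"
proof -
  define g where "g z = frechet_derivative f (at z) a" for z
  \<comment> \<open>The increment of \<open>f\<close> by \<open>t *\<^sub>R b\<close>, viewed as a
    function along \<open>a\<close>; its own increment over the interval from 0 to \<open>t\<close>
    is the second difference.\<close>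
  define \<phi> where "\<phi> u = f ((x + t *\<^sub>R b) + u *\<^sub>R a) - f (x + u *\<^sub>R a)" for u
  have "(\<phi> has_real_derivative g ((x + t *\<^sub>R b) + u *\<^sub>R a) - g (x + u *\<^sub>R a)) (at u)"
    if "0 \<le> u" "u \<le> t" for u
    unfolding \<phi>_def g_def using S[of u 0] S[of u t] that \<open>t > 0\<close>
    by (intro DERIV_diff has_real_derivative_along_line f) (auto simp: algebra_simps)
  from MVT2[OF \<open>t > 0\<close> this] obtain u where u: "0 < u" "u < t"
    and \<phi>: "\<phi> t - \<phi> 0 = (t - 0) * (g ((x + t *\<^sub>R b) + u *\<^sub>R a) - g (x + u *\<^sub>R a))"
    by blast
  define \<psi> where "\<psi> v = g ((x + u *\<^sub>R a) + v *\<^sub>R b)" for v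
  have "(\<psi> has_real_derivative frechet_derivative g (at ((x + u *\<^sub>R a) + v *\<^sub>R b)) b) (at v)"
    if "0 \<le> v" "v \<le> t" for v
    unfolding \<psi>_def using S[of u v] f' that u
    by (intro has_real_derivative_along_line) (auto simp: g_def[abs_def])
  from MVT2[OF \<open>t > 0\<close> this] obtain v where v: "0 < v" "v < t"
    and \<psi>: "\<psi> t - \<psi> 0 = (t - 0) * frechet_derivative g (at ((x + u *\<^sub>R a) + v *\<^sub>R b)) b"
    by blast
  have "f (x + t *\<^sub>R a + t *\<^sub>R b) - f (x + t *\<^sub>R a) - f (x + t *\<^sub>R b) + f x = \<phi> t - \<phi> 0"
    by (simp add: \<phi>_def algebra_simps)
  also have "\<dots> = t * (\<psi> t - \<psi> 0)"
    by (simp add: \<phi> \<psi>_def algebra_simps)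
  also have "\<dots> = t\<^sup>2 * frechet_derivative g (at (x + u *\<^sub>R a + v *\<^sub>R b)) b"
    by (simp add: \<psi> power2_eq_square)
  finally show ?thesis
    using u v by (intro bexI[of _ u] bexI[of _ v]) (simp_all add: g_def[abs_def])
qed

text \<open>The second difference is symmetric in \<open>a\<close> and \<open>b\<close>, so it
  equals the square of \<open>t\<close> times either mixed derivative at points near
  \<open>x\<close>. If the two differed at \<open>x\<close>, continuity would keep them apart on a
  small ball.\<close>

lemma mixed_derivatives_commute:
  fixes f :: "'a::real_normed_vector \<Rightarrow> real"
  defines "f' \<equiv> \<lambda>a z. frechet_derivative f (at z) a"
  assumes "open S" "x \<in> S"
    and f: "\<And>z. z \<in> S \<Longrightarrow> f differentiable (at z)"
    and fa: "\<And>z. z \<in> S \<Longrightarrow> f' a differentiable (at z)"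
    and fb: "\<And>z. z \<in> S \<Longrightarrow> f' b differentiable (at z)"
    and cab: "continuous_on S (\<lambda>z. frechet_derivative (f' a) (at z) b)"
    and cba: "continuous_on S (\<lambda>z. frechet_derivative (f' b) (at z) a)"
  shows "frechet_derivative (f' a) (at x) b = frechet_derivative (f' b) (at x) a"
proof (rule ccontr)
  define A where "A z = frechet_derivative (f' a) (at z) b" for z
  define B where "B z = frechet_derivative (f' b) (at z) a" for z
  assume "\<not> ?thesis"
  then have "A x \<noteq> B x" by (simp add: A_def B_def)
  define e where "e = \<bar>A x - B x\<bar> / 2"
  have "e > 0" using \<open>A x \<noteq> B x\<close> by (simp add: e_def)
  obtain d1 where d1: "d1 > 0" "\<And>z. z \<in> S \<Longrightarrow> dist z x < d1 \<Longrightarrow> dist (A z) (A x) < e"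
    using cab \<open>e > 0\<close> \<open>x \<in> S\<close> unfolding continuous_on_iff A_def by metis
  obtain d2 where d2: "d2 > 0" "\<And>z. z \<in> S \<Longrightarrow> dist z x < d2 \<Longrightarrow> dist (B z) (B x) < e"
    using cba \<open>e > 0\<close> \<open>x \<in> S\<close> unfolding continuous_on_iff B_def by metis
  obtain r where r: "r > 0" "ball x r \<subseteq> S"
    using \<open>open S\<close> \<open>x \<in> S\<close> openE by blast
  define d where "d = min r (min d1 d2)"
  have d: "d > 0" "ball x d \<subseteq> S" "d \<le> d1" "d \<le> d2"
    using r d1(1) d2(1) by (auto simp: d_def)
  \<comment> \<open>This size keeps the parallelogram with sides \<open>t *\<^sub>R a\<close> and
    \<open>t *\<^sub>R b\<close> inside the ball of radius \<open>d\<close>; the summand 1 covers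
    the case that both vectors are zero.\<close>
  define t where "t = d / (norm a + norm b + 1)"
  have N: "norm a + norm b + 1 > 0" by (smt (verit) norm_ge_zero)
  have "t > 0" using d(1) N by (simp add: t_def)
  have near: "x + u *\<^sub>R a + v *\<^sub>R b \<in> ball x d" if "0 \<le> u" "u \<le> t" "0 \<le> v" "v \<le> t" for u v
  proof -
    have "norm (u *\<^sub>R a + v *\<^sub>R b) \<le> u * norm a + v * norm b"
      using norm_triangle_ineq[of "u *\<^sub>R a" "v *\<^sub>R b"] that by simp
    also have "\<dots> \<le> t * norm a + t * norm b"
      using that by (intro add_mono mult_right_mono) auto
    also have "\<dots> < t * (norm a + norm b + 1)"
      using \<open>t > 0\<close> by (simp add: algebra_simps)
    also have "\<dots> = d" using N by (simp add: t_def)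
    finally have "norm (u *\<^sub>R a + v *\<^sub>R b) < d" .
    moreover have "dist x (x + w) = norm w" for w by (simp add: dist_norm)
    ultimately show ?thesis by (simp only: mem_ball add.assoc)
  qed
  have nearS: "x + u *\<^sub>R a + v *\<^sub>R b \<in> S" if "0 \<le> u" "u \<le> t" "0 \<le> v" "v \<le> t" for u v
    using near[OF that] d(2) by blast
  obtain u v where uv: "u \<in> {0<..<t}" "v \<in> {0<..<t}" and
    1: "f (x + t *\<^sub>R a + t *\<^sub>R b) - f (x + t *\<^sub>R a) - f (x + t *\<^sub>R b) + f x =
      t\<^sup>2 * A (x + u *\<^sub>R a + v *\<^sub>R b)"
    using second_difference_mvt[OF \<open>t > 0\<close> nearS f fa[unfolded f'_def]]
    unfolding A_def f'_def by blast
  \<comment> \<open>The summands are reordered to match \<open>second_difference_mvt\<close> with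
    \<open>a\<close> and \<open>b\<close> exchanged.\<close>
  have near': "x + v *\<^sub>R b + u *\<^sub>R a \<in> ball x d" if "0 \<le> u" "u \<le> t" "0 \<le> v" "v \<le> t" for u v
    using near[OF that] by (simp add: ac_simps)
  have nearS': "x + v *\<^sub>R b + u *\<^sub>R a \<in> S" if "0 \<le> v" "v \<le> t" "0 \<le> u" "u \<le> t" for u v
    using near'[OF that(3,4,1,2)] d(2) by blast
  obtain v' u' where uv': "u' \<in> {0<..<t}" "v' \<in> {0<..<t}" and
    2: "f (x + t *\<^sub>R b + t *\<^sub>R a) - f (x + t *\<^sub>R b) - f (x + t *\<^sub>R a) + f x =
      t\<^sup>2 * B (x + v' *\<^sub>R b + u' *\<^sub>R a)"
    using second_difference_mvt[OF \<open>t > 0\<close> nearS' f fb[unfolded f'_def]]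
    unfolding B_def f'_def by blast
  let ?z = "x + u *\<^sub>R a + v *\<^sub>R b" and ?w = "x + v' *\<^sub>R b + u' *\<^sub>R a"
  have "t\<^sup>2 * A ?z = t\<^sup>2 * B ?w"
    using 1 2 by (simp add: algebra_simps)
  then have "A ?z = B ?w" using \<open>t > 0\<close> by simp
  moreover have "?z \<in> ball x d" "?w \<in> ball x d"
    using near[of u v] near'[of u' v'] uv uv' by auto
  then have "dist (A ?z) (A x) < e" "dist (B ?w) (B x) < e"
    using d d1(2)[of ?z] d2(2)[of ?w] by (auto simp: dist_commute)
  \<comment> \<open>The common value of \<open>A ?z\<close> and \<open>B ?w\<close> lies within
    \<open>e\<close> of both \<open>A x\<close> and \<open>B x\<close>, which are
    \<open>2 * e\<close> apart.\<close>
  ultimately show False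
    unfolding e_def dist_real_def by (smt (verit) field_sum_of_halves)
qed

section \<open>Regularity of the data\<close>

text \<open>The axis vectors belong to \<open>Basis\<close>, so unfolding \<open>Ck_on\<close> twice
  yields statements about \<open>partial\<close>; openness of \<open>U\<close> turns
  differentiability on \<open>U\<close> into differentiability at its points.\<close>

lemma Ck_on_2_partial:
  assumes "Ck_on 2 U s" "open U"
  shows "z \<in> U \<Longrightarrow> s differentiable (at z)"
    and "z \<in> U \<Longrightarrow> partial i s differentiable (at z)"
    and "continuous_on U (partial j (partial i s))"
proof -
  have B: "axis i (1::real) \<in> Basis" for i :: 4
    by (simp add: axis_in_Basis_iff)
  have C: "Ck_on (Suc (Suc 0)) U s" using assms(1) by (simp add: numeral_2_eq_2)
  then show "z \<in> U \<Longrightarrow> s differentiable (at z)"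
    using assms(2) by (simp add: differentiable_on_eq_differentiable_at)
  from C B show "z \<in> U \<Longrightarrow> partial i s differentiable (at z)"
    using assms(2) by (simp add: differentiable_on_eq_differentiable_at partial_def[abs_def])
  from C B show "continuous_on U (partial j (partial i s))"
    by (simp add: partial_def[abs_def])
qed

lemma partial_commute:
  assumes "Ck_on 2 U s" "open U" "x \<in> U"
  shows "partial i (partial j s) x = partial j (partial i s) x"
proof -
  note D = Ck_on_2_partial[OF assms(1,2), unfolded partial_def[abs_def]]
  show ?thesis
    using mixed_derivatives_commute[OF assms(2,3), of s "axis j 1" "axis i 1",
        OF D(1) D(2) D(2) D(3) D(3)]
    unfolding partial_def[abs_def] by simp
qed

lemma differentiable_divD:
  assumes "\<And>i. partial i s differentiable (at x)"
  shows "divD s differentiable (at x)"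
  unfolding divD_def[abs_def] by (rule differentiable_sum) (simp_all add: assms)

lemma smooth_on_kappa_differentiable:
  assumes "smooth_on UNIV h" "\<And>t. h t > 0"
  shows "kappa h differentiable (at t)"
proof -
  have C: "Ck_on (Suc (Suc 0)) UNIV h" using assms(1) by (simp add: smooth_on_def)
  then have h: "h differentiable (at t)" for t
    by (simp add: differentiable_on_def)
  \<comment> \<open>\<open>Ck_on\<close> speaks of the Frechet derivative in the direction 1,
    \<open>kappa\<close> of \<open>deriv\<close>; identifying the two makes the second layer of
    \<open>Ck_on\<close> available for \<open>deriv h\<close>.\<close>
  have "deriv h = (\<lambda>t. frechet_derivative h (at t) 1)"
  proof (rule ext)
    fix t
    have "(h has_derivative frechet_derivative h (at t)) (at t)"
      using h frechet_derivative_works by blast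
    then have "(h has_real_derivative frechet_derivative h (at t) 1) (at t)"
      by (rule has_derivative_imp_has_field_derivative)
        (metis h frechet_derivative_eq_vector_derivative mult.commute mult_1 real_scaleR_def)
    then show "deriv h t = frechet_derivative h (at t) 1" by (rule DERIV_imp_deriv)
  qed
  then have "deriv h differentiable (at t)"
    using C by (simp add: differentiable_on_def)
  then show ?thesis
    unfolding kappa_def[abs_def] using h assms(2)[of t]
    by (intro differentiable_mult differentiable_divide differentiable_const) auto
qed

section \<open>Differentiability of the frame fields\<close>

lemma differentiable_vec_lambda:
  fixes f :: "'a::real_normed_vector \<Rightarrow> 'n::finite \<Rightarrow> real"
  assumes "\<And>i. (\<lambda>x. f x i) differentiable F"
  shows "(\<lambda>x. \<chi> i. f x i) differentiable F"
proof -
  have "(\<chi> i. f x i) = (\<Sum>i\<in>UNIV. f x i *\<^sub>R axis i 1)" for x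
    by (simp add: vec_eq_iff axis_def mult_delta_right)
  moreover have "(\<lambda>x. f x i *\<^sub>R axis i (1::real)) differentiable F" for i
    using assms[of i] unfolding differentiable_def by (elim exE) (rule exI, rule has_derivative_scaleR_left)
  ultimately show ?thesis by (simp add: differentiable_sum)
qed

lemma jet_projections_differentiable [simp]:
  "jt differentiable F" "jx differentiable F" "jy differentiable F"
  "(\<lambda>p. jy p $ i) differentiable F"
proof -
  note fst = bounded_linear_fst and snd = bounded_linear_snd
  show "jt differentiable F" "jx differentiable F" "jy differentiable F"
    by (rule bounded_linear_imp_differentiable[OF fst]
        bounded_linear_imp_differentiable[OF bounded_linear_compose[OF fst snd]]
        bounded_linear_imp_differentiable[OF bounded_linear_compose[OF snd snd]])+
  show "(\<lambda>p. jy p $ i) differentiable F"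
    by (rule bounded_linear_imp_differentiable[OF bounded_linear_compose[OF
          bounded_linear_vec_nth bounded_linear_compose[OF snd snd]]])
qed

lemma differentiable_jx:
  "f differentiable (at (jx p)) \<Longrightarrow> (\<lambda>q. f (jx q)) differentiable (at p)"
  by (rule differentiable_compose) simp_all

lemma differentiable_jt:
  "f differentiable (at (jt p)) \<Longrightarrow> (\<lambda>q. f (jt q)) differentiable (at p)"
  by (rule differentiable_compose) simp_all

lemma frame_differentiable:
  assumes k: "kappa h differentiable (at (jt p))"
    and s: "\<And>i. partial i s differentiable (at (jx p))"
  shows "frame h s a differentiable (at p)"
proof (cases a)
  case T
  have "(\<lambda>q. nlc_M h i q) differentiable (at p)" for i
    unfolding nlc_M_def
    by (intro differentiable_mult differentiable_minus differentiable_jt[OF k]) simp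
  then show ?thesis
    unfolding T frame.simps[abs_def]
    by (intro differentiable_Pair differentiable_const differentiable_vec_lambda differentiable_minus)
next
  case (H j)
  have "(\<lambda>q. nlc_N s i j q) differentiable (at p)" for i
    unfolding nlc_N_def S1_def
    by (intro differentiable_add differentiable_mult differentiable_minus differentiable_sum
        differentiable_diff differentiable_divide differentiable_const ballI
        differentiable_jx[OF s] differentiable_jx[OF differentiable_divD[OF s]]) simp_all
  then show ?thesis
    unfolding H frame.simps[abs_def]
    by (intro differentiable_Pair differentiable_const differentiable_vec_lambda differentiable_minus)
next
  case (V j)
  then show ?thesis
    unfolding V frame.simps[abs_def] by simp
qed

text \<open>Serves to move the projections \<open>jt\<close> and \<open>jx\<close> through
  derivatives, both of the frame fields and of functions of one jet coordinate block.\<close>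

lemma frechet_derivative_bounded_linear_comp:
  assumes "bounded_linear L" "f differentiable (at x)"
  shows "frechet_derivative (\<lambda>x. L (f x)) (at x) v = L (frechet_derivative f (at x) v)"
proof -
  have "(f has_derivative frechet_derivative f (at x)) (at x)"
    using assms(2) frechet_derivative_works by blast
  from frechet_derivative_at[OF bounded_linear.has_derivative[OF assms(1) this]]
  show ?thesis by metis
qed

section \<open>The connection in the adapted frame\<close>

lemma sum_adapted_delta:
  fixes f :: "adapted \<Rightarrow> real"
  shows "sum_adapted (\<lambda>c. (if a = c then 1 else 0) * f c) = f a"
    and "sum_adapted (\<lambda>c. f c * (if a = c then 1 else 0)) = f a"
  by (cases a; simp add: sum_adapted_def mult_delta_left mult_delta_right)+

lemma coeff_zero: "coeff h s d (\<lambda>q. 0) p = 0"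
  by (cases d) simp_all

lemma coeff_add: "coeff h s d (\<lambda>q. X q + Y q) p = coeff h s d X p + coeff h s d Y p"
  by (cases d) (simp_all add: algebra_simps sum.distrib)

lemma coeff_diff: "coeff h s d (\<lambda>q. X q - Y q) p = coeff h s d X p - coeff h s d Y p"
  by (cases d) (simp_all add: algebra_simps sum_subtractf)

text \<open>The factor may vary with the point, since \<open>coeff\<close> involves no derivative of
  the field.\<close>

lemma coeff_scaleR: "coeff h s d (\<lambda>q. r q *\<^sub>R X q) p = r p * coeff h s d X p"
  by (cases d) (simp_all add: algebra_simps sum_distrib_left)

lemma coeff_sum: "finite A \<Longrightarrow> coeff h s d (\<lambda>q. \<Sum>i\<in>A. X i q) p = (\<Sum>i\<in>A. coeff h s d (X i) p)"
  by (induction A rule: finite_induct) (simp_all add: coeff_zero coeff_add)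

lemma coeff_sum_adapted:
  "coeff h s d (\<lambda>q. sum_adapted (\<lambda>a. X a q)) p = sum_adapted (\<lambda>a. coeff h s d (X a) p)"
  by (simp add: sum_adapted_def coeff_add coeff_sum)

text \<open>\<open>conn h s d b a\<close> is the component along \<open>e\<^sub>d\<close> of the covariant derivative of \<open>e\<^sub>a\<close>
  along \<open>e\<^sub>b\<close>.\<close>

fun conn :: "(real \<Rightarrow> real) \<Rightarrow> (real^4 \<Rightarrow> real) \<Rightarrow> adapted \<Rightarrow> adapted \<Rightarrow> adapted \<Rightarrow> jet \<Rightarrow> real" where
  "conn h s T T T p = kappa h (jt p)"
| "conn h s (V i) T (V j) p = - kappa h (jt p) * kdelta i j"
| "conn h s (H i) (H k) (H j) p = cartan_L s i j k (jx p)"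
| "conn h s (V i) (H k) (V j) p = cartan_L s i j k (jx p)"
| "conn h s _ _ _ p = 0"

lemma coeff_cartan_frame: "coeff h s d (cartan_frame h s b a) = conn h s d b a"
proof (rule ext)
  fix p
  note simps = coeff_sum coeff_scaleR coeff_zero coeff_frame
  show "coeff h s d (cartan_frame h s b a) p = conn h s d b a p"
    by (cases a; cases b; cases d)
      (simp_all add: cartan_frame.simps[abs_def] simps kdelta_def mult_delta_right
        del: coeff.simps frame.simps scaleR_minus_left)
qed

text \<open>Pairing with the dual coframe leaves a single Lie derivative, that of the component
  along \<open>d\<close>, next to the connection terms.\<close>

lemma coeff_nabla:
  "coeff h s d (cartan_nabla h s X Y) p = lie_deriv X (coeff h s d Y) p
     + sum_adapted (\<lambda>a. sum_adapted (\<lambda>b. coeff h s b X p * coeff h s a Y p * conn h s d b a p))"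
proof -
  have "coeff h s d (cartan_nabla h s X Y) p = sum_adapted (\<lambda>a.
      lie_deriv X (coeff h s a Y) p * (if a = d then 1 else 0)
      + sum_adapted (\<lambda>b. coeff h s b X p * coeff h s a Y p * conn h s d b a p))"
    by (simp add: cartan_nabla_def[abs_def] coeff_sum_adapted coeff_add coeff_scaleR coeff_frame
        coeff_cartan_frame del: coeff.simps frame.simps)
  also have "\<dots> = sum_adapted (\<lambda>a. lie_deriv X (coeff h s a Y) p * (if d = a then 1 else 0))
      + sum_adapted (\<lambda>a. sum_adapted (\<lambda>b. coeff h s b X p * coeff h s a Y p * conn h s d b a p))"
    by (simp add: sum_adapted_def sum.distrib eq_commute[of _ d])
  finally show ?thesis by (simp add: sum_adapted_delta)
qed

lemma lie_deriv_const: "lie_deriv X (\<lambda>q. c) p = 0"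
  by (simp add: lie_deriv_def)

lemma lie_deriv_jt:
  assumes "f differentiable (at (jt p))"
  shows "lie_deriv X (\<lambda>q. f (jt q)) p = frechet_derivative f (at (jt p)) (jt (X p))"
proof -
  have "frechet_derivative (f \<circ> jt) (at p) = frechet_derivative f (at (jt p)) \<circ> frechet_derivative jt (at p)"
    using assms by (intro frechet_derivative_compose) simp_all
  moreover have "frechet_derivative jt (at p) v = jt v" for v
    using frechet_derivative_bounded_linear_comp[of jt "\<lambda>q. q" p] by (simp add: bounded_linear_fst)
  ultimately show ?thesis by (simp add: lie_deriv_def o_def)
qed

lemma lie_deriv_jx:
  assumes "f differentiable (at (jx p))"
  shows "lie_deriv X (\<lambda>q. f (jx q)) p = frechet_derivative f (at (jx p)) (jx (X p))"
proof -
  have "frechet_derivative (f \<circ> jx) (at p) = frechet_derivative f (at (jx p)) \<circ> frechet_derivative jx (at p)"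
    using assms by (intro frechet_derivative_compose) simp_all
  moreover have "frechet_derivative jx (at p) v = jx v" for v
    using frechet_derivative_bounded_linear_comp[of jx "\<lambda>q. q" p]
      bounded_linear_compose[OF bounded_linear_fst bounded_linear_snd] by simp
  ultimately show ?thesis by (simp add: lie_deriv_def o_def)
qed

lemma frechet_derivative_at_zero:
  "f differentiable (at x) \<Longrightarrow> frechet_derivative f (at x) 0 = 0"
  using linear_0[OF linear_frechet_derivative] by blast

text \<open>The frame fields have constant \<open>dt\<close>- and \<open>dx\<^sup>i\<close>-components, so that their brackets are
  vertical and \<open>\<nabla>\<close> along these brackets annihilates the frame.\<close>

lemma lie_bracket_frame_vertical:
  assumes "\<And>a. frame h s a differentiable (at p)"
  shows "coeff h s T (lie_bracket (frame h s c) (frame h s b)) p = 0"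
    and "coeff h s (H i) (lie_bracket (frame h s c) (frame h s b)) p = 0"
proof -
  have "jt (frechet_derivative (frame h s a) (at p) v) = 0" for a v
  proof -
    have "(\<lambda>q. jt (frame h s a q)) = (\<lambda>q. if a = T then 1 else 0)" by (cases a) auto
    then show ?thesis
      by (simp flip: frechet_derivative_bounded_linear_comp[OF bounded_linear_fst assms])
  qed
  then show "coeff h s T (lie_bracket (frame h s c) (frame h s b)) p = 0"
    by (simp add: lie_bracket_def)
  have "jx (frechet_derivative (frame h s a) (at p) v) = 0" for a v
  proof -
    have "(\<lambda>q. jx (frame h s a q)) = (\<lambda>q. case a of H j \<Rightarrow> axis j 1 | _ \<Rightarrow> 0)" by (cases a) auto
    then show ?thesis
      using frechet_derivative_bounded_linear_comp[OF bounded_linear_compose[OF bounded_linear_fst bounded_linear_snd] assms, of a v]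
      by simp
  qed
  then show "coeff h s (H i) (lie_bracket (frame h s c) (frame h s b)) p = 0"
    by (simp add: lie_bracket_def)
qed

text \<open>The components of a frame field are constant, so its first covariant derivative has
  components \<open>conn\<close>, and the Leibniz rule then yields one derivative and one product
  term. The bracket term drops out because brackets are vertical and \<open>conn\<close> vanishes
  along \<open>V\<close>.\<close>

lemma curv_comp_conn:
  assumes "\<And>a. frame h s a differentiable (at p)"
  shows "curv_comp h s d a b c p =
    lie_deriv (frame h s c) (conn h s d b a) p - lie_deriv (frame h s b) (conn h s d c a) p
    + sum_adapted (\<lambda>r. conn h s r b a p * conn h s d c r p)
    - sum_adapted (\<lambda>r. conn h s r c a p * conn h s d b r p)"
proof -
  have frame_const: "coeff h s e (frame h s a) = (\<lambda>p. if a = e then 1 else 0)" for e a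
    by (rule ext) (rule coeff_frame)
  have n: "coeff h s d (cartan_nabla h s (frame h s e) (cartan_nabla h s (frame h s f) (frame h s a))) p
    = lie_deriv (frame h s e) (conn h s d f a) p + sum_adapted (\<lambda>r. conn h s r f a p * conn h s d e r p)"
    for e f
  proof -
    have "cartan_nabla h s (frame h s f) (frame h s a) = cartan_frame h s f a"
      by (rule ext) (rule cartan_nabla_frame)
    then show ?thesis
      by (simp add: coeff_nabla coeff_cartan_frame coeff_frame mult.assoc sum_adapted_delta
          del: coeff.simps frame.simps)
  qed
  have "coeff h s d (cartan_nabla h s (lie_bracket (frame h s c) (frame h s b)) (frame h s a)) p
    = sum_adapted (\<lambda>e. (if a = e then 1 else 0) * sum_adapted (\<lambda>f. 
       coeff h s f (lie_bracket (frame h s c) (frame h s b)) p * conn h s d f e p))"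
    unfolding coeff_nabla frame_const lie_deriv_const
    by (simp add: sum_adapted_def sum_distrib_left algebra_simps del: coeff.simps frame.simps)
  also have "\<dots> = sum_adapted (\<lambda>f. 
       coeff h s f (lie_bracket (frame h s c) (frame h s b)) p * conn h s d f a p)"
    by (rule sum_adapted_delta)
  also have "\<dots> = 0"
    by (simp add: sum_adapted_def lie_bracket_frame_vertical[OF assms] del: coeff.simps frame.simps)
  finally show ?thesis
    by (simp add: curv_comp_def cartan_curvature_def[abs_def] coeff_diff n del: coeff.simps frame.simps)
qed

text \<open>Intended for the products of a temporal coefficient, a multiple of the identity on the
  vertical fields, with a horizontal one.\<close>

lemma kdelta_sum_scaled:
  "(\<Sum>m\<in>UNIV. c * (kdelta m i * f m)) = c * f i"
  "(\<Sum>m\<in>UNIV. f m * (c * kdelta i m)) = f i * c"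
  by (simp_all add: kdelta_def mult_delta_left mult_delta_right)

section \<open>Derivatives and contractions of the horizontal coefficients\<close>

lemma
  assumes s: "\<And>i. partial i s differentiable (at x)"
  shows cartan_L_differentiable: "cartan_L s l i j differentiable (at x)"
    and partial_cartan_L: "partial k (cartan_L s l i j) x =
      kdelta l i * partial k (partial j s) x + kdelta l j * partial k (partial i s) x
      + (1 - kdelta i j) * partial k (partial l s) x - (1 - kdelta i j) / 3 * partial k (divD s) x"
proof -
  have d: "(partial i s has_derivative frechet_derivative (partial i s) (at x)) (at x)" for i
    using s frechet_derivative_works by blast
  have D: "(divD s has_derivative frechet_derivative (divD s) (at x)) (at x)"
    using differentiable_divD[OF s] frechet_derivative_works by blast
  have *: "(cartan_L s l i j has_derivative (\<lambda>v.
      kdelta l i * frechet_derivative (partial j s) (at x) v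
      + kdelta l j * frechet_derivative (partial i s) (at x) v
      + (1 - kdelta i j) * frechet_derivative (partial l s) (at x) v
      - (1 - kdelta i j) / 3 * frechet_derivative (divD s) (at x) v)) (at x)"
    unfolding cartan_L_def[abs_def]
    by (intro has_derivative_diff has_derivative_add has_derivative_mult_right d D)
  then show "cartan_L s l i j differentiable (at x)"
    by (auto simp: differentiable_def)
  from frechet_derivative_at[OF *, symmetric] show "partial k (cartan_L s l i j) x =
      kdelta l i * partial k (partial j s) x + kdelta l j * partial k (partial i s) x
      + (1 - kdelta i j) * partial k (partial l s) x - (1 - kdelta i j) / 3 * partial k (divD s) x"
    by (simp add: partial_def)
qed

text \<open>With \<open>\<tau>\<^sub>l = \<sigma>\<^sub>l - div D\<^sub>\<sigma> / 3\<close> one has \<open>\<Sum>\<^sub>r \<tau>\<^sub>r = - div D\<^sub>\<sigma> / 3\<close>, so that the terms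
  \<open>\<tau>\<^sub>l \<sigma>\<^sub>k + \<tau>\<^sub>l (\<Sum>\<^sub>r \<tau>\<^sub>r - \<tau>\<^sub>k)\<close> of the contraction cancel.\<close>

lemma cartan_L_contraction:
  "(\<Sum>r\<in>UNIV. cartan_L s r i j x * cartan_L s l r k x) =
    partial j s x * cartan_L s l i k x + partial i s x * cartan_L s l j k x
    + (1 - kdelta i j) * kdelta l k * (grad_norm_sq s x - (divD s x)\<^sup>2 / 3)"
proof -
  define a where "a i = partial i s x" for i
  define D where "D = divD s x"
  define \<tau> where "\<tau> i = a i - D / 3" for i
  have D: "(\<Sum>i\<in>UNIV. a i) = D" by (simp add: a_def D_def divD_def)
  have L: "cartan_L s r i j x = kdelta r i * a j + kdelta r j * a i + (1 - kdelta i j) * \<tau> r" for r i j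
    by (simp add: cartan_L_def \<tau>_def a_def D_def algebra_simps)
  \<comment> \<open>Dimension four enters here: the sum is \<open>D - 4 * D / 3\<close>.\<close>
  have \<tau>: "(\<Sum>r\<in>UNIV. \<tau> r) = - D / 3"
    by (simp add: \<tau>_def sum_subtractf D)
  have \<tau>a: "(\<Sum>r\<in>UNIV. \<tau> r * a r) = grad_norm_sq s x - D\<^sup>2 / 3"
    by (simp add: \<tau>_def left_diff_distrib sum_subtractf grad_norm_sq_def a_def[symmetric] D
        power2_eq_square flip: sum_distrib_left sum_divide_distrib)
  have "(\<Sum>r\<in>UNIV. \<tau> r * cartan_L s l r k x) = 
      (\<Sum>r\<in>UNIV. kdelta l r * (\<tau> r * a k) + kdelta l k * (\<tau> r * a r)
        + \<tau> l * \<tau> r - kdelta r k * (\<tau> l * \<tau> r))"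
    by (rule sum.cong) (simp_all add: L algebra_simps)
  also have "\<dots> = \<tau> l * a k + kdelta l k * (grad_norm_sq s x - D\<^sup>2 / 3)
      + \<tau> l * (- D / 3) - \<tau> l * \<tau> k"
    by (simp only: sum.distrib sum_subtractf kdelta_sum \<tau> \<tau>a flip: sum_distrib_left)
  also have "\<dots> = kdelta l k * (grad_norm_sq s x - D\<^sup>2 / 3)"
    by (simp add: \<tau>_def[of k] algebra_simps)
  finally have c: "(\<Sum>r\<in>UNIV. \<tau> r * cartan_L s l r k x) = kdelta l k * (grad_norm_sq s x - D\<^sup>2 / 3)" .
  \<comment> \<open>Only the first factor is expanded: its Kronecker terms select
    \<open>r = i\<close> and \<open>r = j\<close>, and \<open>c\<close> evaluates the rest.\<close>
  have "(\<Sum>r\<in>UNIV. cartan_L s r i j x * cartan_L s l r k x) =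
     (\<Sum>r\<in>UNIV. kdelta r i * (a j * cartan_L s l r k x) + kdelta r j * (a i * cartan_L s l r k x)
       + (1 - kdelta i j) * (\<tau> r * cartan_L s l r k x))"
    by (rule sum.cong) (simp_all add: L[of _ i j] algebra_simps)
  also have "\<dots> = a j * cartan_L s l i k x + a i * cartan_L s l j k x
      + (1 - kdelta i j) * (kdelta l k * (grad_norm_sq s x - D\<^sup>2 / 3))"
    by (simp only: sum.distrib kdelta_sum c flip: sum_distrib_left)
  finally show ?thesis by (simp add: a_def D_def)
qed

text \<open>Antisymmetrizing the contraction in \<open>j\<close> and \<open>k\<close> removes
  \<open>partial i s x * cartan_L s l j k x\<close> by symmetry of the lower indices. Symmetry of
  the second derivatives is used for the term with factor \<open>kdelta l i\<close>.\<close>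

lemma frakR_eq:
  assumes "Ck_on 2 U s" "open U" "x \<in> U"
  shows "frakR s l i j k x = partial k (cartan_L s l i j) x - partial j (cartan_L s l i k) x
    + (\<Sum>r\<in>UNIV. cartan_L s r i j x * cartan_L s l r k x)
    - (\<Sum>r\<in>UNIV. cartan_L s r i k x * cartan_L s l r j x)"
proof -
  note s = Ck_on_2_partial(2)[OF assms(1,2,3)]
  have c: "kdelta u v = kdelta v u" for u v by (auto simp: kdelta_def)
  show ?thesis
    unfolding cartan_L_contraction partial_cartan_L[OF s]
    unfolding frakR_def Let_def cartan_L_def
      partial_commute[OF assms, of j k] c[of k j]
    by (simp add: algebra_simps add_divide_distrib diff_divide_distrib)
qed

section \<open>Evaluation of all adapted curvature components\<close>

theorem proposition3p3:
  fixes M :: "'m topology" and \<A> :: "'m chart set" and \<sigma> :: "'m \<Rightarrow> real"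
    and h :: "real \<Rightarrow> real" and c :: "'m chart"
  assumes "smooth_on UNIV h" and "\<And>t. h t > 0"
    and "smooth_manifold M \<A>"
    and "smooth_function \<A> \<sigma>" and "\<not> \<sigma> constant_on topspace M"
    and "c \<in> \<A>"
  shows "\<forall>p \<in> jet_domain (coord_range c).
    (\<forall>l i j k. curv_R h (coord_rep c \<sigma>) l i j k p = frakR (coord_rep c \<sigma>) l i j k (jx p)) \<and>
    (\<forall>l i j k. curv_comp h (coord_rep c \<sigma>) (V l) (V i) (H j) (H k) p
       = curv_R h (coord_rep c \<sigma>) l i j k p) \<and>
    (\<forall>d a b e.
       (\<nexists>l i j k. d = H l \<and> a = H i \<and> b = H j \<and> e = H k) \<and>
       (\<nexists>l i j k. d = V l \<and> a = V i \<and> b = H j \<and> e = H k) \<longrightarrow>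
       curv_comp h (coord_rep c \<sigma>) d a b e p = 0)"
proof
  fix p
  assume "p \<in> jet_domain (coord_range c)"
  define s where "s = coord_rep c \<sigma>"
  define U where "U = coord_range c"
  have x: "jx p \<in> U"
    using \<open>p \<in> _\<close> by (simp add: jet_domain_def U_def)
  have U: "open U"
    using assms(3,6) by (simp add: smooth_manifold_def smooth_atlas_def U_def)
  have C2: "Ck_on 2 U s"
    using assms(4,6) by (simp add: smooth_function_def smooth_on_def s_def U_def)
  note ds = Ck_on_2_partial(2)[OF C2 U x]
  note dk = smooth_on_kappa_differentiable[OF assms(1,2)]
  note dL = cartan_L_differentiable[OF ds]
  note curv = curv_comp_conn[OF frame_differentiable[OF dk ds]]
  have lie_L: "lie_deriv X (\<lambda>q. cartan_L s l i j (jx q)) p =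
      frechet_derivative (cartan_L s l i j) (at (jx p)) (jx (X p))" for X l i j
    by (rule lie_deriv_jx[OF dL])
  have lie_k: "lie_deriv X (\<lambda>q. kappa h (jt q)) p =
      frechet_derivative (kappa h) (at (jt p)) (jt (X p))" for X
    by (rule lie_deriv_jt[OF dk])
  \<comment> \<open>This is the simplified shape of the temporal coefficient on vertical fields,
    with a Kronecker symbol for \<open>r\<close>.\<close>
  have lie_k': "lie_deriv X (\<lambda>q. - (kappa h (jt q) * r)) p =
      frechet_derivative (\<lambda>t. - (kappa h t * r)) (at (jt p)) (jt (X p))" for X r
    by (rule lie_deriv_jt) (simp add: dk)
  \<comment> \<open>\<open>T\<close> and \<open>V\<close> have zero \<open>jx\<close> part,
    \<open>H\<close> and \<open>V\<close> zero \<open>jt\<close> part; hence \<open>cartan_L\<close>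
    is constant along the former and \<open>kappa\<close> along the latter.\<close>
  have zero: "frechet_derivative (cartan_L s l i j) (at (jx p)) 0 = 0"
    "frechet_derivative (kappa h) (at (jt p)) 0 = 0"
    "frechet_derivative (\<lambda>t. - (kappa h t * r)) (at (jt p)) 0 = 0" for l i j r
    by (simp_all add: frechet_derivative_at_zero dL dk)
  note eval = curv conn.simps[abs_def] lie_deriv_const lie_L lie_k lie_k' zero sum_adapted_def
  \<comment> \<open>Along \<open>H\<close> the connection preserves the horizontal and the vertical
    block and acts on both with the same coefficients, so one identity for \<open>frakR\<close>
    settles this claim and the next.\<close>
  have HH: "curv_comp h s (H l) (H i) (H j) (H k) p = frakR s l i j k (jx p)" for l i j k
    by (simp add: eval frakR_eq[OF C2 U x] partial_def)
  have VV: "curv_comp h s (V l) (V i) (H j) (H k) p = frakR s l i j k (jx p)" for l i j k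
    by (simp add: eval frakR_eq[OF C2 U x] partial_def)
  \<comment> \<open>Mixed blocks vanish because \<open>conn\<close> never leaves a block. In the
    vertical block with one direction \<open>T\<close> and one \<open>H\<close>, the two products
    cancel since the \<open>T\<close> coefficient is a multiple of the identity.\<close>
  have "curv_comp h s d a b e p = 0"
    if "\<nexists>l i j k. d = H l \<and> a = H i \<and> b = H j \<and> e = H k"
      "\<nexists>l i j k. d = V l \<and> a = V i \<and> b = H j \<and> e = H k" for d a b e
    using that
    by (cases d; cases a; cases b; cases e)
      (simp_all add: eval kdelta_sum_scaled mult.assoc sum_negf)
  with HH VV show "(\<forall>l i j k. curv_R h (coord_rep c \<sigma>) l i j k p = frakR (coord_rep c \<sigma>) l i j k (jx p)) \<and>
    (\<forall>l i j k. curv_comp h (coord_rep c \<sigma>) (V l) (V i) (H j) (H k) p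
       = curv_R h (coord_rep c \<sigma>) l i j k p) \<and>
    (\<forall>d a b e.
       (\<nexists>l i j k. d = H l \<and> a = H i \<and> b = H j \<and> e = H k) \<and>
       (\<nexists>l i j k. d = V l \<and> a = V i \<and> b = H j \<and> e = H k) \<longrightarrow>
       curv_comp h (coord_rep c \<sigma>) d a b e p = 0)"
    unfolding s_def[symmetric] curv_R_def by metis
qed

end
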